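(* Let $l\ge 2$ be an integer, and let $G$ be a finite simple graph on $n$ vertices, where $n=3l+2$ or $n=3l+3$, given by one of the following constructions. Type 1 ($n=3l+2$): $G=\mathbb{S}_{4l}$ is the graph consisting of two copies $S_{2l}$ and $S'_{2l}$ of the star graph with $2l$ edges having exactly $l$ common vertices, these being leaves (non-central vertices) of both stars. Type 2 ($n=3l+3$): $G=\mathbb{S}_{4l+1}$ is the graph consisting of two star graphs $S_{2l}$ and $S_{2l+1}$ having exactly $l$ common vertices, these being leaves (non-central vertices) of both stars. Then, in either case, $G$ is an $f$-Gallai graph.
   Context: Star graph: $S_m=K_{1,m}$ is the complete bipartite graph on $m+1$ vertices with $m$ edges, formed by connecting a single central vertex to $m$ other vertices (the leaves). In the constructions, the edges of the two stars can be labelled $e_1,\dots,e_{2l}$ and $e'_1,\dots,e'_{2l}$ (respectively $e'_1,\dots,e'_{2l+1}$) so that $e_i$ and $e'_i$ have a common leaf for $i=1,\dots,l$; the two central vertices are distinct, there are no other coincidences of vertices, and $E(G)$ is the union of the two edge sets. Gallai graph: for a graph $G$, the Gallai graph $\Gamma(G)$ has vertex set $E(G)$, and two distinct edges of $G$ are adjacent in $\Gamma(G)$ if and only if they share an endpoint in $G$ and do not span a triangle in $G$. Edge ideal: for a simple graph $H$ on vertices $v_1,\dots,v_m$, the edge ideal $I(H)$ is the ideal of $S=k[x_1,\dots,x_m]$ ($k$ an infinite field) generated by the monomials $x_ix_j$ with $\{v_i,v_j\}\in E(H)$. Facet and non-face complexes: let $I\subset S=k[x_1,\dots,x_m]$ be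 a square-free monomial ideal with minimal monomial generating set $\{M_1,\dots,M_q\}$. The facet complex $\delta_{\mathcal F}(I)$ is the simplicial complex on $v_1,\dots,v_m$ with facets $F_i=\{v_j : x_j\mid M_i\}$, $1\le i\le q$. The non-face (Stanley–Reisner) complex $\delta_{\mathcal N}(I)$ is the simplicial complex on $v_1,\dots,v_m$ in which $\{v_{i_1},\dots,v_{i_s}\}$ is a face if and only if $x_{i_1}\cdots x_{i_s}\notin I$. $f$-vector: for a simplicial complex $\Delta$ of dimension $N$, the $f$-vector is $(f_0,\dots,f_N)$, where $f_i$ is the number of $i$-dimensional faces (faces with $i+1$ vertices). $f$-ideal: a square-free monomial ideal $I$ is an $f$-ideal if $\delta_{\mathcal F}(I)$ and $\delta_{\mathcal N}(I)$ have the same $f$-vector. $f$-Gallai graph: a finite simple graph $G$ is an $f$-Gallai graph if the edge ideal $I(\Gamma(G))$ of its Gallai graph $\Gamma(G)$ is an $f$-ideal. *)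

theory Defs
  imports "HOL-Algebra.Ideal" "HOL-Algebra.Divisibility" "HOL-Library.Poly_Mapping"
begin

section \<open>Simple graphs, stars, and the Gallai graph\<close>

record 'a ugraph =
  verts :: "'a set"
  edges :: "'a set set"

definition finite_simple_graph :: "'a ugraph \<Rightarrow> bool" where
  "finite_simple_graph G \<longleftrightarrow>
     finite (verts G) \<and> (\<forall>e\<in>edges G. e \<subseteq> verts G \<and> card e = 2)"

definition leaves :: "'a \<Rightarrow> 'a ugraph \<Rightarrow> 'a set" where
  "leaves c S = verts S - {c}"

definition star_graph :: "nat \<Rightarrow> 'a \<Rightarrow> 'a ugraph \<Rightarrow> bool" where
  "star_graph m c S \<longleftrightarrow>
     finite (verts S) \<and> c \<in> verts S \<and> card (leaves c S) = m \<and>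
     edges S = {{c, x} | x. x \<in> leaves c S}"

text \<open>
  The union of two stars with \<open>p\<close> and \<open>q\<close> edges which have exactly \<open>l\<close> vertices in common,
  all of them leaves of both stars. In particular neither centre lies on the other star.
\<close>
definition double_star :: "nat \<Rightarrow> nat \<Rightarrow> nat \<Rightarrow> 'a ugraph \<Rightarrow> bool" where
  "double_star p q l G \<longleftrightarrow>
     (\<exists>S S' c c'. star_graph p c S \<and> star_graph q c' S' \<and>
        card (verts S \<inter> verts S') = l \<and>
        verts S \<inter> verts S' \<subseteq> leaves c S \<inter> leaves c' S' \<and>
        verts G = verts S \<union> verts S' \<and>
        edges G = edges S \<union> edges S')"

definition spans_triangle :: "'a ugraph \<Rightarrow> 'a set \<Rightarrow> 'a set \<Rightarrow> bool" where
  "spans_triangle G e f \<longleftrightarrow>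
     (\<exists>a b c. distinct [a, b, c] \<and> e = {a, b} \<and> f = {a, c} \<and>
        {a, b} \<in> edges G \<and> {a, c} \<in> edges G \<and> {b, c} \<in> edges G)"

definition Gallai_graph :: "'a ugraph \<Rightarrow> 'a set ugraph" where
  "Gallai_graph G =
     \<lparr>verts = edges G,
      edges = {{e, f} | e f. e \<in> edges G \<and> f \<in> edges G \<and> e \<noteq> f \<and>
                 e \<inter> f \<noteq> {} \<and> \<not> spans_triangle G e f}\<rparr>"


section \<open>Polynomial rings, monomial ideals and edge ideals\<close>

text \<open>
  Polynomials with coefficients in \<open>'k\<close> and variables indexed by the type \<open>'v\<close> are finitely
  supported functions from exponent vectors to coefficients. The ring \<open>k[x\<^sub>v : v \<in> V]\<close> is the
  subring of those polynomials that only involve variables indexed by \<open>V\<close>; ideals and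
  divisibility are taken in this subring.
\<close>
type_synonym ('v, 'k) mpolynomial = "('v \<Rightarrow>\<^sub>0 nat) \<Rightarrow>\<^sub>0 'k"

definition mpoly_ring :: "'v set \<Rightarrow> ('v, 'k::field) mpolynomial ring" where
  "mpoly_ring V =
     \<lparr>carrier = {p. \<forall>m\<in>Poly_Mapping.keys p. Poly_Mapping.keys m \<subseteq> V},
      monoid.mult = (*), one = 1, zero = 0, add = (+)\<rparr>"

lemma cring_mpoly_ring: "cring (mpoly_ring V :: ('v, 'k::field) mpolynomial ring)"
proof (rule cringI)
  let ?R = "mpoly_ring V :: ('v, 'k) mpolynomial ring"
  have ops: "x \<oplus>\<^bsub>?R\<^esub> y = x + y" "x \<otimes>\<^bsub>?R\<^esub> y = x * y" "\<zero>\<^bsub>?R\<^esub> = 0" "\<one>\<^bsub>?R\<^esub> = 1" for x y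
    by (simp_all add: mpoly_ring_def)
  have zero_one: "0 \<in> carrier ?R" "1 \<in> carrier ?R"
    by (simp_all add: mpoly_ring_def)
  have add_closed: "p + q \<in> carrier ?R" if "p \<in> carrier ?R" "q \<in> carrier ?R" for p q
    unfolding mpoly_ring_def partial_object.simps
  proof (intro CollectI ballI)
    fix m assume "m \<in> Poly_Mapping.keys (p + q)"
    then have "m \<in> Poly_Mapping.keys p \<or> m \<in> Poly_Mapping.keys q"
      using Poly_Mapping.keys_add[of p q] by (metis UnE subsetD)
    then show "Poly_Mapping.keys m \<subseteq> V"
      using that by (elim disjE) (simp_all add: mpoly_ring_def)
  qed
  have mult_closed: "p * q \<in> carrier ?R" if "p \<in> carrier ?R" "q \<in> carrier ?R" for p q
    unfolding mpoly_ring_def partial_object.simps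
  proof (intro CollectI ballI)
    fix m assume "m \<in> Poly_Mapping.keys (p * q)"
    then obtain a b where ab: "m = a + b" "a \<in> Poly_Mapping.keys p" "b \<in> Poly_Mapping.keys q"
      using keys_mult[of p q] by fast
    then have "Poly_Mapping.keys a \<subseteq> V" "Poly_Mapping.keys b \<subseteq> V"
      using that by (simp_all add: mpoly_ring_def)
    then show "Poly_Mapping.keys m \<subseteq> V"
      using Poly_Mapping.keys_add[of a b] ab(1) by (meson Un_least order_trans)
  qed
  show "abelian_group ?R"
  proof (rule abelian_groupI)
    fix p assume "p \<in> carrier ?R"
    then have "- p \<in> carrier ?R" by (simp add: mpoly_ring_def)
    then show "\<exists>q\<in>carrier ?R. q \<oplus>\<^bsub>?R\<^esub> p = \<zero>\<^bsub>?R\<^esub>"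
      by (intro bexI[of _ "- p"]) (simp_all add: ops)
  qed (unfold ops, (rule add_closed zero_one add.assoc add.commute add_0_left; assumption?)+)
  show "Group.comm_monoid ?R"
    by (rule comm_monoidI, unfold ops)
      ((rule mult_closed zero_one mult.assoc mult.commute mult_1_left; assumption?)+)
qed (simp add: mpoly_ring_def distrib_right)

definition monom_of :: "('v \<Rightarrow>\<^sub>0 nat) \<Rightarrow> ('v, 'k::field) mpolynomial" where
  "monom_of m = Poly_Mapping.single m 1"

definition var :: "'v \<Rightarrow> ('v, 'k::field) mpolynomial" where
  "var v = monom_of (Poly_Mapping.single v 1)"

definition monomials :: "'v set \<Rightarrow> ('v, 'k::field) mpolynomial set" where
  "monomials V = {monom_of m | m. Poly_Mapping.keys m \<subseteq> V}"

definition squarefree_monomials :: "'v set \<Rightarrow> ('v, 'k::field) mpolynomial set" where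
  "squarefree_monomials V =
     {monom_of m | m. Poly_Mapping.keys m \<subseteq> V \<and> (\<forall>v. Poly_Mapping.lookup m v \<le> 1)}"

definition squarefree_monomial_ideal ::
    "'v set \<Rightarrow> ('v, 'k::field) mpolynomial set \<Rightarrow> bool" where
  "squarefree_monomial_ideal V I \<longleftrightarrow>
     (\<exists>M \<subseteq> squarefree_monomials V. I = genideal (mpoly_ring V) M)"

text \<open>
  A monomial ideal has exactly one inclusion-minimal generating set consisting of monomials
  (with coefficient 1), so the description is proper for every monomial ideal.
\<close>
definition min_monomial_gens ::
    "'v set \<Rightarrow> ('v, 'k::field) mpolynomial set \<Rightarrow> ('v, 'k) mpolynomial set" where
  "min_monomial_gens V I =
     (THE M. M \<subseteq> monomials V \<and> genideal (mpoly_ring V) M = I \<and>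
             (\<forall>N. N \<subset> M \<longrightarrow> genideal (mpoly_ring V) N \<noteq> I))"

definition edge_ideal :: "'v ugraph \<Rightarrow> ('v, 'k::field) mpolynomial set" where
  "edge_ideal H =
     genideal (mpoly_ring (verts H)) {var u * var v | u v. {u, v} \<in> edges H}"


section \<open>Facet complex, non-face complex, and f-ideals\<close>

definition facet_complex ::
    "'v set \<Rightarrow> ('v, 'k::field) mpolynomial set \<Rightarrow> 'v set set" where
  "facet_complex V I =
     {F. \<exists>M \<in> min_monomial_gens V I. F \<subseteq> {v \<in> V. var v divides\<^bsub>mpoly_ring V\<^esub> M}}"

definition nonface_complex ::
    "'v set \<Rightarrow> ('v, 'k::field) mpolynomial set \<Rightarrow> 'v set set" where
  "nonface_complex V I = {F. F \<subseteq> V \<and> (\<Prod>v\<in>F. var v) \<notin> I}"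

text \<open>
  The dimension of a finite complex. Inserting \<open>0\<close> only matters for the complex without any
  faces, which is given dimension \<open>-1\<close> and hence, like the complex \<open>{{}}\<close>, the empty f-vector.
\<close>
definition complex_dim :: "'v set set \<Rightarrow> int" where
  "complex_dim D = int (Max (insert 0 (card ` D))) - 1"

definition f_vector :: "'v set set \<Rightarrow> nat list" where
  "f_vector D = map (\<lambda>i. card {F \<in> D. card F = i + 1}) [0..<nat (complex_dim D + 1)]"

definition f_ideal :: "'v set \<Rightarrow> ('v, 'k::field) mpolynomial set \<Rightarrow> bool" where
  "f_ideal V I \<longleftrightarrow>
     squarefree_monomial_ideal V I \<and>
     f_vector (facet_complex V I) = f_vector (nonface_complex V I)"

definition f_Gallai_graph :: "'k::field itself \<Rightarrow> 'a ugraph \<Rightarrow> bool" where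
  "f_Gallai_graph K G \<longleftrightarrow>
     finite_simple_graph G \<and>
     f_ideal (verts (Gallai_graph G))
       (edge_ideal (Gallai_graph G) :: ('a set, 'k) mpolynomial set)"

end

theory Submission
  imports Defs
begin

text \<open>
  An edge ideal is generated by the monomials of an antichain of exponent vectors, so these are its
  unique minimal monomial generators. Hence the facet complex consists of the subsets of edges
  and the non-face complex of the independent sets. If no vertex is isolated, no three vertices are
  independent and exactly half of the pairs of vertices are edges, the two \<open>f\<close>-vectors agree. The
  Gallai graph of a double star is the union of two cliques, one per star, joined by a matching
  with one edge per common leaf, because a double star has no triangles. For cliques of sizes
  \<open>2 l\<close> and \<open>2 l\<close> (or \<open>2 l + 1\<close>) and a matching of size \<open>l\<close> the edge count is exactly half.
\<close>

section \<open>Monomial ideals\<close>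

lemma mpoly_ring_simps [simp]:
  "monoid.mult (mpoly_ring V) = (*)" "one (mpoly_ring V) = 1"
  "zero (mpoly_ring V) = 0" "add (mpoly_ring V) = (+)"
  by (simp_all add: mpoly_ring_def)

lemma carrier_mpoly_ring:
  "p \<in> carrier (mpoly_ring V) \<longleftrightarrow> (\<forall>m\<in>Poly_Mapping.keys p. Poly_Mapping.keys m \<subseteq> V)"
  by (simp add: mpoly_ring_def)

lemma keys_monom_of [simp]: "Poly_Mapping.keys (monom_of m :: ('v, 'k::field) mpolynomial) = {m}"
  by (simp add: monom_of_def)

lemma inj_monom_of: "inj (monom_of :: _ \<Rightarrow> ('v, 'k::field) mpolynomial)"
  by (rule injI) (metis keys_monom_of singleton_inject)

lemma monom_of_mult: "monom_of a * monom_of b = monom_of (a + b)"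
  by (simp add: monom_of_def mult_single)

lemma monom_of_0: "monom_of 0 = 1"
  by (simp add: monom_of_def single_one)

text \<open>The candidate for the ideal generated by the monomials with exponents in
  \<open>A\<close>. Divisibility of monomials is the additive relation \<open>k = a + b\<close>, so
  membership is a condition on exponents alone.\<close>

definition multiples_ideal ::
    "'v set \<Rightarrow> ('v \<Rightarrow>\<^sub>0 nat) set \<Rightarrow> ('v, 'k::field) mpolynomial set" where
  "multiples_ideal V A =
     {p \<in> carrier (mpoly_ring V). \<forall>k\<in>Poly_Mapping.keys p. \<exists>a\<in>A. \<exists>b. k = a + b}"

lemma ideal_multiples_ideal:
  "ideal (multiples_ideal V A :: ('v, 'k::field) mpolynomial set) (mpoly_ring V)"
proof -
  let ?R = "mpoly_ring V :: ('v, 'k) mpolynomial ring"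
  let ?J = "multiples_ideal V A :: ('v, 'k) mpolynomial set"
  interpret R: cring ?R by (rule cring_mpoly_ring)
  have mult: "q * p \<in> ?J" if p: "p \<in> ?J" and q: "q \<in> carrier ?R" for p q
  proof -
    have "\<exists>a\<in>A. \<exists>b. k = a + b" if k: "k \<in> Poly_Mapping.keys (q * p)" for k
    proof -
      obtain x y where "k = x + y" "y \<in> Poly_Mapping.keys p"
        using k keys_mult[of q p] by fast
      moreover from this p obtain a b where "a \<in> A" "y = a + b"
        by (auto simp: multiples_ideal_def)
      ultimately show ?thesis by (metis add.left_commute)
    qed
    moreover have "q * p \<in> carrier ?R"
      using R.m_closed[of q p] p q by (simp add: multiples_ideal_def)
    ultimately show ?thesis by (simp add: multiples_ideal_def)
  qed
  show ?thesis
  proof (rule idealI)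
    show "ring ?R" by (rule R.ring_axioms)
    show "subgroup ?J (add_monoid ?R)"
    proof
      show "?J \<subseteq> carrier (add_monoid ?R)" by (auto simp: multiples_ideal_def)
    next
      fix p q assume pq: "p \<in> ?J" "q \<in> ?J"
      have "p + q \<in> carrier ?R"
        using R.a_closed[of p q] pq by (simp add: multiples_ideal_def)
      then show "p \<otimes>\<^bsub>add_monoid ?R\<^esub> q \<in> ?J"
        using pq Poly_Mapping.keys_add[of p q] by (auto simp: multiples_ideal_def)
    next
      show "\<one>\<^bsub>add_monoid ?R\<^esub> \<in> ?J"
        by (simp add: multiples_ideal_def carrier_mpoly_ring)
    next
      fix p assume p: "p \<in> ?J"
      then have neg: "- p \<in> ?J"
        by (simp add: multiples_ideal_def carrier_mpoly_ring)
      \<comment> \<open>The inverse in the additive group is given abstractly; it is identified with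
        \<open>- p\<close>, which has the same support as \<open>p\<close>.\<close>
      have "\<ominus>\<^bsub>?R\<^esub> p = - p"
        by (rule R.minus_equality) (use p neg in \<open>simp_all add: multiples_ideal_def\<close>)
      then show "inv\<^bsub>add_monoid ?R\<^esub> p \<in> ?J"
        using neg by (simp add: a_inv_def)
    qed
  next
    fix p q assume "p \<in> ?J" "q \<in> carrier ?R"
    then show "q \<otimes>\<^bsub>?R\<^esub> p \<in> ?J" "p \<otimes>\<^bsub>?R\<^esub> q \<in> ?J"
      using mult[of p q] by (simp_all add: mult.commute)
  qed
qed

text \<open>One inclusion is minimality of the generated ideal. For the other, a polynomial is the
  sum of its terms, and a term with exponent \<open>a + b\<close> is a generator times a term with
  exponent \<open>b\<close>.\<close>

lemma genideal_monomials:
  assumes "\<And>a. a \<in> A \<Longrightarrow> Poly_Mapping.keys a \<subseteq> V"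
  shows "genideal (mpoly_ring V) (monom_of ` A) =
         (multiples_ideal V A :: ('v, 'k::field) mpolynomial set)"
proof
  let ?R = "mpoly_ring V :: ('v, 'k) mpolynomial ring"
  let ?J = "multiples_ideal V A :: ('v, 'k) mpolynomial set"
  let ?I = "genideal ?R (monom_of ` A)"
  interpret R: cring ?R by (rule cring_mpoly_ring)
  have sub: "monom_of ` A \<subseteq> carrier ?R"
    using assms by (auto simp: carrier_mpoly_ring)
  have "monom_of ` A \<subseteq> ?J"
    using sub by (force simp: multiples_ideal_def intro: exI[of _ 0])
  then show "?I \<subseteq> ?J"
    by (rule R.genideal_minimal[OF ideal_multiples_ideal])
  interpret I: ideal ?I ?R by (rule R.genideal_ideal[OF sub])
  show "?J \<subseteq> ?I"
  proof
    fix p assume p: "p \<in> ?J"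
    have monomial: "Poly_Mapping.single k (Poly_Mapping.lookup p k) \<in> ?I"
      if k: "k \<in> Poly_Mapping.keys p" for k
    proof -
      let ?c = "Poly_Mapping.lookup p k"
      obtain a b where ab: "a \<in> A" "k = a + b"
        using p k by (auto simp: multiples_ideal_def)
      \<comment> \<open>Natural exponents cannot cancel, so the cofactor involves only variables of
        \<open>V\<close> and lies in the subring.\<close>
      have "Poly_Mapping.keys b \<subseteq> Poly_Mapping.keys k"
        unfolding ab(2) by (auto simp: in_keys_iff lookup_add)
      also have "\<dots> \<subseteq> V"
        using p k by (auto simp: multiples_ideal_def carrier_mpoly_ring)
      finally have "Poly_Mapping.single b ?c \<in> carrier ?R"
        by (auto simp: carrier_mpoly_ring)
      moreover have "monom_of a \<in> ?I"
        using R.genideal_self[OF sub] ab(1) by blast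
      ultimately have "Poly_Mapping.single b ?c * monom_of a \<in> ?I"
        using I.I_l_closed by fastforce
      then show ?thesis
        by (simp add: monom_of_def mult_single ab(2) add.commute)
    qed
    have "(\<Sum>k\<in>K. Poly_Mapping.single k (Poly_Mapping.lookup p k)) \<in> ?I"
      if "K \<subseteq> Poly_Mapping.keys p" "finite K" for K
      using that(2,1)
    proof (induction K)
      case empty
      then show ?case using I.zero_closed by simp
    next
      case (insert k K)
      then show ?case using I.a_closed monomial by simp
    qed
    moreover have "(\<Sum>k\<in>Poly_Mapping.keys p. Poly_Mapping.single k (Poly_Mapping.lookup p k)) = p"
      by (rule poly_mapping_eqI) (simp add: lookup_sum lookup_single when_def in_keys_iff)
    ultimately show "p \<in> ?I" by (metis finite_keys order_refl)
  qed
qed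

section \<open>Uniqueness of minimal monomial generating sets\<close>

lemma monom_of_in_multiples_ideal:
  "monom_of k \<in> (multiples_ideal V A :: ('v, 'k::field) mpolynomial set) \<longleftrightarrow>
     Poly_Mapping.keys k \<subseteq> V \<and> (\<exists>a\<in>A. \<exists>b. k = a + b)"
  by (simp add: multiples_ideal_def carrier_mpoly_ring)

text \<open>Each \<open>e\<close> in \<open>E\<close> is a multiple of some \<open>b\<close> in
  \<open>B\<close>, which is a multiple of some \<open>a\<close> in \<open>E\<close>. Since
  \<open>E\<close> is an antichain, the composite quotient \<open>d + c\<close> vanishes, so
  \<open>e = b\<close>.\<close>

lemma generators_contain_antichain:
  assumes B: "\<And>b. b \<in> B \<Longrightarrow> Poly_Mapping.keys b \<subseteq> V"
    and E: "\<And>a. a \<in> E \<Longrightarrow> Poly_Mapping.keys a \<subseteq> V"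
    and anti: "\<And>a b c. a \<in> E \<Longrightarrow> b \<in> E \<Longrightarrow> a = b + c \<Longrightarrow> c = 0"
    and eq: "(multiples_ideal V B :: ('v, 'k::field) mpolynomial set) = multiples_ideal V E"
  shows "E \<subseteq> B"
proof
  fix e assume e: "e \<in> E"
  then have "monom_of e \<in> (multiples_ideal V E :: ('v, 'k) mpolynomial set)"
    using E by (auto simp: monom_of_in_multiples_ideal intro!: bexI[of _ e] exI[of _ 0])
  then obtain b c where bc: "b \<in> B" "e = b + c"
    unfolding eq[symmetric] monom_of_in_multiples_ideal by blast
  have "monom_of b \<in> (multiples_ideal V B :: ('v, 'k) mpolynomial set)"
    using B bc(1) by (auto simp: monom_of_in_multiples_ideal intro!: bexI[of _ b] exI[of _ 0])
  then obtain a d where ad: "a \<in> E" "b = a + d"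
    unfolding eq monom_of_in_multiples_ideal by blast
  have "d + c = 0"
    using anti[OF e ad(1), of "d + c"] bc(2) ad(2) by (simp add: add.assoc)
  then have "c = 0"
    by (metis add_eq_0_iff_both_eq_0 lookup_add lookup_zero poly_mapping_eqI)
  then show "e \<in> B" using bc by simp
qed

text \<open>Every monomial generating set of the ideal contains the monomials of \<open>E\<close>.
  Hence no proper subset of these generates, and an inclusion-minimal generating set cannot be
  larger; this settles the definite description.\<close>

lemma min_monomial_gens_antichain:
  assumes E: "\<And>a. a \<in> E \<Longrightarrow> Poly_Mapping.keys a \<subseteq> V"
    and anti: "\<And>a b c. a \<in> E \<Longrightarrow> b \<in> E \<Longrightarrow> a = b + c \<Longrightarrow> c = 0"
  shows "min_monomial_gens V (genideal (mpoly_ring V) (monom_of ` E)) =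
         (monom_of ` E :: ('v, 'k::field) mpolynomial set)"
proof -
  let ?I = "genideal (mpoly_ring V) (monom_of ` E :: ('v, 'k) mpolynomial set)"
  have mono: "monom_of ` E \<subseteq> (monomials V :: ('v, 'k) mpolynomial set)"
    using E by (auto simp: monomials_def)
  have contains: "monom_of ` E \<subseteq> M"
    if M: "M \<subseteq> monomials V" "genideal (mpoly_ring V) M = ?I"
    for M :: "('v, 'k) mpolynomial set"
  proof -
    \<comment> \<open>The set \<open>M\<close> is pulled back to exponents, where the antichain
      argument applies.\<close>
    define B where "B = {m. monom_of m \<in> M}"
    have MB: "M = monom_of ` B"
      using M(1) by (auto simp: B_def monomials_def)
    have B: "Poly_Mapping.keys b \<subseteq> V" if "b \<in> B" for b
    proof -
      have "(monom_of b :: ('v, 'k) mpolynomial) \<in> monomials V"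
        using that M(1) by (auto simp: B_def)
      then show ?thesis
        by (auto simp: monomials_def dest: injD[OF inj_monom_of])
    qed
    have "(multiples_ideal V B :: ('v, 'k) mpolynomial set) = multiples_ideal V E"
      using M(2) unfolding MB by (simp only: genideal_monomials[OF B] genideal_monomials[OF E])
    then have "E \<subseteq> B"
      using generators_contain_antichain[of B V E] B E anti by blast
    then show ?thesis unfolding MB by blast
  qed
  show ?thesis
    unfolding min_monomial_gens_def
  proof (rule the_equality)
    have minimal: "genideal (mpoly_ring V) N \<noteq> ?I" if N: "N \<subset> monom_of ` E" for N
    proof
      assume "genideal (mpoly_ring V) N = ?I"
      moreover have "N \<subseteq> monomials V" using N mono by (auto dest: psubset_imp_subset)
      ultimately have "monom_of ` E \<subseteq> N" by (rule contains[rotated])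
      then show False using N by (simp add: less_le_not_le)
    qed
    show "monom_of ` E \<subseteq> (monomials V :: ('v, 'k) mpolynomial set) \<and>
        genideal (mpoly_ring V) (monom_of ` E) = ?I \<and>
        (\<forall>N. N \<subset> monom_of ` E \<longrightarrow> genideal (mpoly_ring V) N \<noteq> ?I)"
      by (intro conjI mono refl allI impI minimal)
  next
    fix M assume M: "M \<subseteq> monomials V \<and> genideal (mpoly_ring V) M = ?I \<and>
      (\<forall>N. N \<subset> M \<longrightarrow> genideal (mpoly_ring V) N \<noteq> ?I)"
    then have "monom_of ` E \<subseteq> M" by (intro contains) simp_all
    moreover have "\<not> monom_of ` E \<subset> M" using M by (metis (no_types))
    ultimately show "M = monom_of ` E" by (simp add: psubset_eq)
  qed
qed

section \<open>Square-free monomials as finite sets of variables\<close>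

section \<open>The complexes of an edge ideal\<close>

text \<open>Indicator vector of \<open>F\<close>. For infinite \<open>F\<close> the sum is 0 and the
  product of variables is 1, so \<open>prod_var\<close> holds for every \<open>F\<close>.\<close>

definition set_exponent :: "'v set \<Rightarrow> 'v \<Rightarrow>\<^sub>0 nat" where
  "set_exponent F = (\<Sum>v\<in>F. Poly_Mapping.single v 1)"

lemma lookup_set_exponent:
  "finite F \<Longrightarrow> Poly_Mapping.lookup (set_exponent F) v = (if v \<in> F then 1 else 0)"
  by (simp add: set_exponent_def lookup_sum lookup_single when_def)

lemma keys_set_exponent: "finite F \<Longrightarrow> Poly_Mapping.keys (set_exponent F) = F"
  by (auto simp: in_keys_iff lookup_set_exponent split: if_splits)

lemma prod_var: "(\<Prod>v\<in>F. var v) = (monom_of (set_exponent F) :: ('v, 'k::field) mpolynomial)"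
proof (cases "finite F")
  case True
  then show ?thesis
    by induction (simp_all add: set_exponent_def monom_of_0 var_def monom_of_mult)
qed (simp add: set_exponent_def monom_of_0)

text \<open>Adding natural exponents cannot shrink a support; conversely \<open>F - e\<close>
  supplies the cofactor. Divisibility of square-free monomials thus becomes inclusion of
  sets.\<close>

lemma set_exponent_multiple_iff:
  assumes "finite e" "finite F"
  shows "(\<exists>b. set_exponent F = set_exponent e + b) \<longleftrightarrow> e \<subseteq> F"
proof
  assume "\<exists>b. set_exponent F = set_exponent e + b"
  then obtain b where b: "set_exponent F = set_exponent e + b" by blast
  show "e \<subseteq> F"
  proof
    fix v assume "v \<in> e"
    then have "Poly_Mapping.lookup (set_exponent F) v \<noteq> 0"
      using assms by (simp add: b lookup_add lookup_set_exponent)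
    then show "v \<in> F"
      using assms by (simp add: lookup_set_exponent split: if_splits)
  qed
next
  assume "e \<subseteq> F"
  then have "set_exponent F = set_exponent e + set_exponent (F - e)"
    using assms unfolding set_exponent_def by (metis add.commute sum.subset_diff)
  then show "\<exists>b. set_exponent F = set_exponent e + b" by blast
qed

lemma var_divides_iff:
  assumes "finite F" "F \<subseteq> V" "v \<in> V"
  shows "var v divides\<^bsub>mpoly_ring V\<^esub> (monom_of (set_exponent F) :: ('v, 'k::field) mpolynomial)
    \<longleftrightarrow> v \<in> F"
proof
  assume "var v divides\<^bsub>mpoly_ring V\<^esub> (monom_of (set_exponent F) :: ('v, 'k) mpolynomial)"
  then obtain p :: "('v, 'k) mpolynomial" where "monom_of (set_exponent F) = var v * p"
    by (auto simp: factor_def)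
  \<comment> \<open>The cofactor is an arbitrary polynomial, but every exponent in the support of
    the product has the exponent of \<open>v\<close> as a summand.\<close>
  then have "set_exponent F \<in> Poly_Mapping.keys (var v * p)"
    by (metis keys_monom_of singletonI)
  then obtain b where "set_exponent F = Poly_Mapping.single v 1 + b"
    using keys_mult[of "var v" p] unfolding var_def keys_monom_of by blast
  then have "Poly_Mapping.lookup (set_exponent F) v \<noteq> 0"
    by (simp add: lookup_add)
  then show "v \<in> F"
    using assms by (simp add: lookup_set_exponent split: if_splits)
next
  assume "v \<in> F"
  then have "(monom_of (set_exponent F) :: ('v, 'k) mpolynomial) =
      var v * monom_of (set_exponent (F - {v}))"
    unfolding prod_var[symmetric] using assms(1) by (rule prod.remove[rotated])
  \<comment> \<open>Divisibility is meant inside the subring, so the cofactor must involve only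
    variables of \<open>V\<close>.\<close>
  moreover have "monom_of (set_exponent (F - {v})) \<in> carrier (mpoly_ring V)"
    using assms by (auto simp: carrier_mpoly_ring keys_set_exponent)
  ultimately show "var v divides\<^bsub>mpoly_ring V\<^esub> (monom_of (set_exponent F) :: ('v, 'k) mpolynomial)"
    by (auto simp: factor_def)
qed

section \<open>Edge ideal, facets and independent sets of a finite simple graph\<close>

context
  fixes H :: "'v ugraph"
  assumes H: "finite_simple_graph H"
begin

lemma edge_props:
  assumes "e \<in> edges H"
  shows "finite e" "e \<subseteq> verts H" "card e = 2"
  using H assms by (auto simp: finite_simple_graph_def intro: finite_subset)

text \<open>The generators are indexed by ordered pairs of endpoints. Edges have two elements, so no
  square of a variable occurs and each product is the square-free monomial of an edge.\<close>

lemma edge_generators: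
  "{var u * var v | u v. {u, v} \<in> edges H} =
     (monom_of ` set_exponent ` edges H :: ('v, 'k::field) mpolynomial set)"
proof -
  have pair: "var u * var v = (monom_of (set_exponent {u, v}) :: ('v, 'k) mpolynomial)"
    if "u \<noteq> v" for u v :: 'v
    using that unfolding prod_var[symmetric] by simp
  have ne: "u \<noteq> v" if "{u, v} \<in> edges H" for u v
    using edge_props(3)[OF that] by auto
  have "M \<in> {var u * var v | u v. {u, v} \<in> edges H}"
    if M: "M \<in> monom_of ` set_exponent ` edges H" for M :: "('v, 'k) mpolynomial"
  proof -
    obtain e where e: "e \<in> edges H" "M = monom_of (set_exponent e)"
      using M by blast
    obtain u v where uv: "e = {u, v}" "u \<noteq> v"
      using edge_props(3)[OF e(1)] by (auto simp: card_2_iff)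
    then have "M = var u * var v \<and> {u, v} \<in> edges H" using e pair[of u v] by simp
    then show ?thesis by blast
  qed
  moreover have "M \<in> monom_of ` set_exponent ` edges H"
    if "M \<in> {var u * var v | u v. {u, v} \<in> edges H}" for M :: "('v, 'k) mpolynomial"
    using that by (auto simp: pair ne)
  ultimately show ?thesis by (intro subset_antisym subsetI)
qed

lemma keys_edge: "a \<in> set_exponent ` edges H \<Longrightarrow> Poly_Mapping.keys a \<subseteq> verts H"
  using edge_props(1,2) by (fastforce simp: keys_set_exponent)

text \<open>All edges have the same size, so one edge monomial divides another only if they
  coincide.\<close>

lemma edge_antichain:
  assumes "a \<in> set_exponent ` edges H" "b \<in> set_exponent ` edges H" "a = b + c"
  shows "c = 0"
proof -
  obtain e f where ef: "e \<in> edges H" "f \<in> edges H" "a = set_exponent e" "b = set_exponent f"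
    using assms by blast
  then have "f \<subseteq> e"
    using assms(3) set_exponent_multiple_iff[of f e] edge_props by metis
  then have "f = e"
    using ef edge_props by (metis card_subset_eq)
  then show ?thesis using ef assms(3) by simp
qed

lemma squarefree_monomial_ideal_edge_ideal:
  "squarefree_monomial_ideal (verts H) (edge_ideal H :: ('v, 'k::field) mpolynomial set)"
proof -
  have "monom_of ` set_exponent ` edges H \<subseteq>
      (squarefree_monomials (verts H) :: ('v, 'k) mpolynomial set)"
  proof
    fix M :: "('v, 'k) mpolynomial" assume "M \<in> monom_of ` set_exponent ` edges H"
    then obtain e where e: "e \<in> edges H" "M = monom_of (set_exponent e)" by blast
    then show "M \<in> squarefree_monomials (verts H)"
      using edge_props[OF e(1)]
      by (auto simp: squarefree_monomials_def keys_set_exponent lookup_set_exponent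
          intro!: exI[of _ "set_exponent e"])
  qed
  then show ?thesis
    unfolding squarefree_monomial_ideal_def edge_ideal_def edge_generators by blast
qed

text \<open>The edge monomials are the minimal generators, and the variables dividing such a
  monomial are the endpoints of its edge.\<close>

lemma facet_complex_edge_ideal:
  "facet_complex (verts H) (edge_ideal H :: ('v, 'k::field) mpolynomial set) =
     {F. \<exists>e\<in>edges H. F \<subseteq> e}"
proof -
  have gens: "min_monomial_gens (verts H) (edge_ideal H :: ('v, 'k) mpolynomial set) =
      monom_of ` set_exponent ` edges H"
    unfolding edge_ideal_def edge_generators
    by (rule min_monomial_gens_antichain[OF keys_edge edge_antichain])
  have "{v \<in> verts H. var v divides\<^bsub>mpoly_ring (verts H)\<^esub>
      (monom_of (set_exponent e) :: ('v, 'k) mpolynomial)} = e" if "e \<in> edges H" for e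
    using edge_props[OF that] var_divides_iff[of e "verts H", where 'k = 'k] by blast
  then show ?thesis by (auto simp: facet_complex_def gens)
qed

text \<open>A square-free monomial lies in the edge ideal exactly if some edge monomial divides it,
  so the faces are the independent sets of \<open>H\<close>.\<close>

lemma nonface_complex_edge_ideal:
  "nonface_complex (verts H) (edge_ideal H :: ('v, 'k::field) mpolynomial set) =
     {F. F \<subseteq> verts H \<and> (\<forall>e\<in>edges H. \<not> e \<subseteq> F)}"
proof -
  have "(\<Prod>v\<in>F. var v) \<in> (edge_ideal H :: ('v, 'k) mpolynomial set) \<longleftrightarrow> (\<exists>e\<in>edges H. e \<subseteq> F)"
    if "F \<subseteq> verts H" for F
  proof -
    have F: "finite F" using H finite_subset[OF that] by (simp add: finite_simple_graph_def)
    have "edge_ideal H =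
        (multiples_ideal (verts H) (set_exponent ` edges H) :: ('v, 'k) mpolynomial set)"
      unfolding edge_ideal_def edge_generators by (rule genideal_monomials) (rule keys_edge)
    then have "(\<Prod>v\<in>F. var v) \<in> (edge_ideal H :: ('v, 'k) mpolynomial set) \<longleftrightarrow>
        (\<exists>e\<in>edges H. \<exists>b. set_exponent F = set_exponent e + b)"
      using that by (simp add: prod_var monom_of_in_multiples_ideal keys_set_exponent[OF F])
    also have "\<dots> \<longleftrightarrow> (\<exists>e\<in>edges H. e \<subseteq> F)"
      by (rule bex_cong[OF refl set_exponent_multiple_iff[OF edge_props(1) F]])
    finally show ?thesis .
  qed
  then show ?thesis by (auto simp: nonface_complex_def)
qed

text \<open>Edges have two vertices and \<open>indep\<close> bounds independent sets by two, so only
  faces with one or two elements matter. The counts of the former agree by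
  \<open>no_isolated\<close>, of the latter by \<open>half\<close>.\<close>

lemma f_ideal_edge_ideal:
  assumes no_isolated: "verts H \<subseteq> \<Union> (edges H)"
    and nonempty: "edges H \<noteq> {}"
    and half: "2 * card (edges H) = card (verts H) choose 2"
    and indep: "\<And>F. F \<subseteq> verts H \<Longrightarrow> \<forall>e\<in>edges H. \<not> e \<subseteq> F \<Longrightarrow> card F \<le> 2"
  shows "f_ideal (verts H) (edge_ideal H :: ('v, 'k::field) mpolynomial set)"
proof -
  define D where "D = {F. \<exists>e\<in>edges H. F \<subseteq> e}"
  define D' where "D' = {F. F \<subseteq> verts H \<and> (\<forall>e\<in>edges H. \<not> e \<subseteq> F)}"
  define P where "P = {F. F \<subseteq> verts H \<and> card F = 2}"
  have finV: "finite (verts H)" using H by (simp add: finite_simple_graph_def)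
  have "D \<subseteq> Pow (verts H)" "D' \<subseteq> Pow (verts H)"
    using edge_props(2) by (auto simp: D_def D'_def)
  then have fin: "finite D" "finite D'"
    using finV by (simp_all add: finite_subset[OF _ iffD2[OF finite_Pow_iff]])
  have finP: "finite P" using finV by (simp add: P_def)
  have EP: "edges H \<subseteq> P" using edge_props by (auto simp: P_def)
  have finE: "finite (edges H)" by (rule finite_subset[OF EP finP])
  have cardP: "card P = card (verts H) choose 2"
    unfolding P_def by (rule n_subsets[OF finV])
  have D2: "{F \<in> D. card F = 2} = edges H"
    using edge_props by (auto simp: D_def) (metis card_subset_eq)
  \<comment> \<open>For a two-element set, containing an edge means being one, so the independent
    pairs are the non-edges.\<close>
  have D'2: "{F \<in> D'. card F = 2} = P - edges H"
  proof -
    have "e = F" if "e \<in> edges H" "F \<in> P" "e \<subseteq> F" for e F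
      using that edge_props(3)[OF that(1)] finite_subset[OF _ finV, of F]
      by (simp add: P_def card_subset_eq)
    then show ?thesis by (auto simp: D'_def P_def)
  qed
  have eq2: "card {F \<in> D'. card F = 2} = card {F \<in> D. card F = 2}"
    unfolding D2 D'2 using card_Diff_subset[OF finE EP] cardP half by simp
  \<comment> \<open>An isolated vertex would be a face of \<open>D'\<close> but not of
    \<open>D\<close>.\<close>
  have D1: "{F \<in> D. card F = 1} = {{v} | v. v \<in> verts H}"
    using no_isolated edge_props(2) unfolding D_def
    by (fastforce simp: card_1_singleton_iff)
  have D'1: "{F \<in> D'. card F = 1} = {{v} | v. v \<in> verts H}"
  proof -
    have "\<not> e \<subseteq> {v}" if "e \<in> edges H" for e v
      using card_mono[of "{v}" e] edge_props(3)[OF that] by auto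
    then show ?thesis by (auto simp: D'_def card_1_singleton_iff)
  qed
  \<comment> \<open>An edge exists, so by \<open>eq2\<close> a non-edge exists too; without one,
    \<open>D'\<close> would not reach dimension 1.\<close>
  have "card (edges H) > 0" using nonempty finE by (simp add: card_gt_0_iff)
  then have ne: "{F \<in> D. card F = 2} \<noteq> {}" "{F \<in> D'. card F = 2} \<noteq> {}"
    using eq2 unfolding D2 by (metis card.empty less_irrefl)+
  have dim: "complex_dim X = 1"
    if "finite X" "{F \<in> X. card F = 2} \<noteq> {}" "\<And>F. F \<in> X \<Longrightarrow> card F \<le> 2"
    for X :: "'v set set"
  proof -
    have "2 \<in> card ` X" using that(2) by force
    then have "Max (insert 0 (card ` X)) = 2"
      using that by (intro Max_eqI) auto
    then show ?thesis by (simp add: complex_dim_def)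
  qed
  have dims: "complex_dim D = 1" "complex_dim D' = 1"
  proof -
    show "complex_dim D = 1"
    proof (rule dim[OF fin(1) ne(1)])
      fix F assume "F \<in> D"
      then obtain e where "e \<in> edges H" "F \<subseteq> e" by (auto simp: D_def)
      then show "card F \<le> 2" using edge_props card_mono by metis
    qed
    show "complex_dim D' = 1"
      by (rule dim[OF fin(2) ne(2)]) (simp add: D'_def indep)
  qed
  \<comment> \<open>In dimension 1 the index list is \<open>[0, 1]\<close>, so only two entries are
    compared.\<close>
  have "f_vector D = f_vector D'"
    using D1 D'1 eq2 unfolding f_vector_def dims
    by (simp add: upt_rec numeral_2_eq_2)
  then show ?thesis
    unfolding f_ideal_def facet_complex_edge_ideal nonface_complex_edge_ideal D_def D'_def
    using squarefree_monomial_ideal_edge_ideal by blast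
qed

end

section \<open>The Gallai graph of a double star\<close>

lemma finite_simple_graph_Gallai:
  assumes "finite_simple_graph G"
  shows "finite_simple_graph (Gallai_graph G)"
proof -
  have "edges G \<subseteq> Pow (verts G)" "finite (Pow (verts G))"
    using assms by (auto simp: finite_simple_graph_def)
  then have "finite (edges G)" by (rule finite_subset)
  then show ?thesis
    by (auto simp: finite_simple_graph_def Gallai_graph_def card_2_iff)
qed

text \<open>Edges of one star meet in its centre, edges of different stars only in a common leaf.
  The set \<open>X\<close> of common leaves indexes the matching, with \<open>a x\<close> and
  \<open>b x\<close> the edges joining \<open>x\<close> to the two centres.\<close>

lemma double_star_Gallai:
  fixes G :: "'a ugraph"
  assumes "double_star p q l G"
  obtains A B :: "'a set set" and X :: "'a set" and a b where
    "finite A" "finite B" "A \<inter> B = {}" "card A = p" "card B = q" "card X = l"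
    "inj_on a X" "a ` X \<subseteq> A" "b ` X \<subseteq> B"
    "verts (Gallai_graph G) = A \<union> B"
    "edges (Gallai_graph G) = {e. e \<subseteq> A \<and> card e = 2} \<union> {e. e \<subseteq> B \<and> card e = 2} \<union>
       (\<lambda>x. {a x, b x}) ` X"
proof -
  obtain S S' c c' where S: "star_graph p c S" and S': "star_graph q c' S'"
    and X: "card (verts S \<inter> verts S') = l"
    and leaf: "verts S \<inter> verts S' \<subseteq> leaves c S \<inter> leaves c' S'"
    and E: "edges G = edges S \<union> edges S'"
    using assms unfolding double_star_def by blast
  define L where "L = leaves c S"
  define L' where "L' = leaves c' S'"
  define X where "X = verts S \<inter> verts S'"
  define a where "a = (\<lambda>x. {c, x})"
  define b where "b = (\<lambda>x. {c', x})"
  have fin: "finite L" "finite L'"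
    using S S' by (auto simp: star_graph_def leaves_def L_def L'_def)
  \<comment> \<open>A centre lying on the other star would be a common vertex, hence a leaf of its
    own star.\<close>
  have centres: "c \<notin> verts S'" "c' \<notin> verts S"
    using S S' leaf by (auto simp: star_graph_def leaves_def)
  have nc: "c \<notin> L" "c \<notin> L'" "c' \<notin> L" "c' \<notin> L'" "c \<noteq> c'"
    using centres S by (auto simp: leaves_def L_def L'_def star_graph_def)
  have XL: "X = L \<inter> L'"
    using leaf by (auto simp: X_def leaves_def L_def L'_def)
  have edges: "edges S = a ` L" "edges S' = b ` L'"
    using S S' by (auto simp: star_graph_def a_def b_def L_def L'_def)
  have inj: "inj_on a L" "inj_on b L'"
    using nc by (auto simp: inj_on_def a_def b_def doubleton_eq_iff)
  have disj: "a ` L \<inter> b ` L' = {}"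
    using nc by (auto simp: a_def b_def doubleton_eq_iff)
  \<comment> \<open>The two centres form one colour class of a proper 2-colouring.\<close>
  have bipartite: "x \<in> {c, c'} \<longleftrightarrow> y \<notin> {c, c'}" if xy: "{x, y} \<in> edges G" for x y
  proof -
    obtain d z where "{x, y} = {d, z}" "d \<in> {c, c'}" "z \<notin> {c, c'}"
    proof -
      consider z where "z \<in> L" "{x, y} = {c, z}" | z where "z \<in> L'" "{x, y} = {c', z}"
        using xy unfolding E edges a_def b_def by blast
      then show thesis using that nc by cases blast+
    qed
    then show ?thesis unfolding doubleton_eq_iff by blast
  qed
  \<comment> \<open>A triangle is an odd cycle, which the 2-colouring forbids; adjacency in the
    Gallai graph is then just meeting.\<close>
  have no_triangle: "\<not> spans_triangle G e f" for e f
  proof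
    assume "spans_triangle G e f"
    then obtain u v w where "{u, v} \<in> edges G" "{u, w} \<in> edges G" "{v, w} \<in> edges G"
      unfolding spans_triangle_def by blast
    from this[THEN bipartite] show False by blast
  qed
  have meet: "a x \<inter> a y \<noteq> {}" "b x \<inter> b y \<noteq> {}" for x y
    by (auto simp: a_def b_def)
  have meet': "a x \<inter> b y \<noteq> {} \<longleftrightarrow> x = y" if "x \<in> L" "y \<in> L'" for x y
    using that nc by (auto simp: a_def b_def)
  have Gallai: "edges (Gallai_graph G) =
      {{e, f} | e f. e \<in> a ` L \<union> b ` L' \<and> f \<in> a ` L \<union> b ` L' \<and> e \<noteq> f \<and> e \<inter> f \<noteq> {}}"
    unfolding Gallai_graph_def using no_triangle by (simp add: E edges)
  have adjacent: "{e, f} \<in> edges (Gallai_graph G)"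
    if "e \<in> a ` L \<union> b ` L'" "f \<in> a ` L \<union> b ` L'" "e \<noteq> f" "e \<inter> f \<noteq> {}" for e f
    unfolding Gallai using that by blast
  show thesis
  proof (rule that[of "a ` L" "b ` L'" X a b])
    show "finite (a ` L)" "finite (b ` L')" using fin by simp_all
    show "a ` L \<inter> b ` L' = {}" by (rule disj)
    show "card (a ` L) = p" "card (b ` L') = q"
      using S S' inj by (simp_all add: card_image star_graph_def L_def L'_def)
    show "card X = l" using X by (simp add: X_def)
    show "inj_on a X" using inj(1) by (rule inj_on_subset) (simp add: XL)
    show "a ` X \<subseteq> a ` L" "b ` X \<subseteq> b ` L'" by (auto simp: XL)
    show "verts (Gallai_graph G) = a ` L \<union> b ` L'"
      by (simp add: Gallai_graph_def E edges)
    show "edges (Gallai_graph G) = {e. e \<subseteq> a ` L \<and> card e = 2} \<union>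
        {e. e \<subseteq> b ` L' \<and> card e = 2} \<union> (\<lambda>x. {a x, b x}) ` X" (is "?E = ?K \<union> ?K' \<union> ?M")
    proof
      show "?E \<subseteq> ?K \<union> ?K' \<union> ?M"
      proof
        fix g assume "g \<in> ?E"
        then obtain e f where ef: "g = {e, f}" "e \<in> a ` L \<union> b ` L'" "f \<in> a ` L \<union> b ` L'"
          "e \<noteq> f" "e \<inter> f \<noteq> {}"
          unfolding Gallai by blast
        \<comment> \<open>Used in both orders below, since either of the two edges may belong to the
          first star.\<close>
        have cross: "{e, f} \<in> ?M" if "e \<in> a ` L" "f \<in> b ` L'" "e \<inter> f \<noteq> {}" for e f
          using that meet' by (auto simp: XL)
        show "g \<in> ?K \<union> ?K' \<union> ?M"
          using ef cross[of e f] cross[of f e]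
          by (auto simp: insert_commute Int_commute)
      qed
      show "?K \<union> ?K' \<union> ?M \<subseteq> ?E"
      proof (intro Un_least subsetI)
        fix g assume "g \<in> ?K"
        then have g: "g \<subseteq> a ` L" "card g = 2" by simp_all
        from g(2) obtain e f where ef: "g = {e, f}" "e \<noteq> f" unfolding card_2_iff by blast
        have "e \<in> a ` L" "f \<in> a ` L" using g(1) ef(1) by simp_all
        then have "e \<inter> f \<noteq> {}" using meet(1) by (elim imageE) simp
        then show "g \<in> ?E" using adjacent[of e f] ef g(1) by blast
      next
        fix g assume "g \<in> ?K'"
        then have g: "g \<subseteq> b ` L'" "card g = 2" by simp_all
        from g(2) obtain e f where ef: "g = {e, f}" "e \<noteq> f" unfolding card_2_iff by blast
        have "e \<in> b ` L'" "f \<in> b ` L'" using g(1) ef(1) by simp_all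
        then have "e \<inter> f \<noteq> {}" using meet(2) by (elim imageE) simp
        then show "g \<in> ?E" using adjacent[of e f] ef g(1) by blast
      next
        fix g assume "g \<in> ?M"
        then obtain x where x: "x \<in> L" "x \<in> L'" "g = {a x, b x}" by (auto simp: XL)
        then have "a x \<noteq> b x" "a x \<inter> b x \<noteq> {}" using disj meet' by blast+
        then show "g \<in> ?E" using adjacent[of "a x" "b x"] x by blast
      qed
    qed
  qed
qed

text \<open>An independent set has at most one vertex in each clique, and cliques of size at least 2
  leave no vertex isolated. The left side of \<open>half\<close> is twice the number of clique and
  matching edges.\<close>

lemma f_Gallai_double_star:
  fixes G :: "'a ugraph"
  assumes G: "finite_simple_graph G" and ds: "double_star p q l G"
    and pq: "p \<ge> 2" "q \<ge> 2"
    and half: "2 * ((p choose 2) + (q choose 2) + l) = (p + q) choose 2"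
  shows "f_Gallai_graph TYPE('k::field) G"
proof -
  let ?H = "Gallai_graph G"
  obtain A B and X :: "'a set" and a b
    where AB: "finite A" "finite B" "A \<inter> B = {}" "card A = p" "card B = q"
    and X: "card X = l" "inj_on a X" "a ` X \<subseteq> A" "b ` X \<subseteq> B"
    and V: "verts ?H = A \<union> B"
    and E: "edges ?H = {e. e \<subseteq> A \<and> card e = 2} \<union> {e. e \<subseteq> B \<and> card e = 2} \<union>
       (\<lambda>x. {a x, b x}) ` X" (is "_ = ?K \<union> ?K' \<union> ?M")
    by (rule double_star_Gallai[OF ds])
  have large: "\<exists>e. e \<subseteq> C \<and> card e = 2 \<and> v \<in> e" if C: "finite C" "2 \<le> card C" "v \<in> C"
    for C :: "'a set set" and v
  proof -
    have "\<not> C \<subseteq> {v}" using C(2) card_mono[of "{v}" C] by auto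
    then obtain w where "w \<in> C" "w \<noteq> v" by blast
    then show ?thesis using C by (intro exI[of _ "{v, w}"]) auto
  qed
  have H: "finite_simple_graph ?H" by (rule finite_simple_graph_Gallai[OF G])
  have "f_ideal (verts ?H) (edge_ideal ?H :: ('a set, 'k) mpolynomial set)"
  proof (rule f_ideal_edge_ideal[OF H])
    show iso: "verts ?H \<subseteq> \<Union> (edges ?H)"
    proof
      fix v assume "v \<in> verts ?H"
      then consider "v \<in> A" | "v \<in> B" unfolding V by blast
      then show "v \<in> \<Union> (edges ?H)"
      proof cases
        case 1
        then obtain e where "e \<subseteq> A \<and> card e = 2 \<and> v \<in> e"
          using large[of A v] AB pq by auto
        then show ?thesis unfolding E by blast
      next
        case 2
        then obtain e where "e \<subseteq> B \<and> card e = 2 \<and> v \<in> e"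
          using large[of B v] AB pq by auto
        then show ?thesis unfolding E by blast
      qed
    qed
    have "A \<noteq> {}" using AB pq by auto
    then show "edges ?H \<noteq> {}" using iso unfolding V by blast
    \<comment> \<open>Disjointness of \<open>A\<close> and \<open>B\<close> tells the endpoints of a
      matching edge apart. This makes the matching injective and keeps its edges out of both
      cliques.\<close>
    have aA: "a x \<in> A" "a x \<notin> B" and bB: "b x \<in> B" "b x \<notin> A" if "x \<in> X" for x
    proof -
      show "a x \<in> A" "b x \<in> B" using X(3,4) that by (simp_all add: image_subset_iff)
      with AB(3) show "a x \<notin> B" "b x \<notin> A" by (auto simp: disjoint_iff)
    qed
    have "card ?M = l"
    proof -
      have "inj_on (\<lambda>x. {a x, b x}) X"
      proof (rule inj_onI)
        fix x y assume xy: "x \<in> X" "y \<in> X" "{a x, b x} = {a y, b y}"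
        \<comment> \<open>Excludes that the two doubletons agree crosswise.\<close>
        have "a x \<noteq> b y" using aA(1)[OF xy(1)] bB(2)[OF xy(2)] by auto
        then have "a x = a y" using xy(3) by (simp add: doubleton_eq_iff)
        then show "x = y" using X(2) xy(1,2) by (simp add: inj_on_eq_iff)
      qed
      then show ?thesis using X(1) by (simp add: card_image)
    qed
    moreover have "card ?K = p choose 2" "card ?K' = q choose 2"
      using n_subsets[OF AB(1), of 2] n_subsets[OF AB(2), of 2] AB by simp_all
    moreover have "finite ?K" "finite ?K'" using AB by simp_all
    moreover have "finite X"
      using X AB(1) by (metis finite_imageD finite_subset)
    moreover have "?K \<inter> ?K' = {}"
    proof -
      have "card e \<noteq> 2" if "e \<subseteq> A" "e \<subseteq> B" for e
      proof -
        have "e \<subseteq> A \<inter> B" using that by (rule Int_greatest)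
        then show ?thesis using AB(3) by simp
      qed
      then show ?thesis by blast
    qed
    moreover have "(?K \<union> ?K') \<inter> ?M = {}" using aA bB by auto
    ultimately have "card (edges ?H) = (p choose 2) + (q choose 2) + l"
      unfolding E by (simp add: card_Un_disjoint)
    then show "2 * card (edges ?H) = card (verts ?H) choose 2"
      using half AB by (simp add: V card_Un_disjoint)
    fix F assume F: "F \<subseteq> verts ?H" "\<forall>e\<in>edges ?H. \<not> e \<subseteq> F"
    \<comment> \<open>Two elements of \<open>F\<close> in one clique would form an edge inside
      \<open>F\<close>.\<close>
    have small: "card (F \<inter> C) \<le> 1" if C: "{e. e \<subseteq> C \<and> card e = 2} \<subseteq> edges ?H" for C
    proof (rule ccontr)
      assume "\<not> card (F \<inter> C) \<le> 1"
      then have "2 \<le> card (F \<inter> C)" by simp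
      then obtain e where "e \<subseteq> F \<inter> C" "card e = 2"
        by (meson obtain_subset_with_card_n)
      then show False using C F(2) by blast
    qed
    have "F = (F \<inter> A) \<union> (F \<inter> B)" using F(1) V by blast
    then have "card F \<le> card (F \<inter> A) + card (F \<inter> B)" by (metis card_Un_le)
    then show "card F \<le> 2" using small[of A] small[of B] unfolding E by fastforce
  qed
  then show ?thesis using G by (simp add: f_Gallai_graph_def)
qed

theorem theorem4p4:
  fixes l n :: nat and G :: "'a ugraph"
  assumes "infinite (UNIV :: 'k::field set)"
    and "l \<ge> 2"
    and "finite_simple_graph G"
    and "card (verts G) = n"
    and "(n = 3 * l + 2 \<and> double_star (2 * l) (2 * l) l G) \<or>
         (n = 3 * l + 3 \<and> double_star (2 * l) (2 * l + 1) l G)"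
  shows "f_Gallai_graph TYPE('k) G"
proof -
  have even: "(2 * m) choose 2 = m * (2 * m - 1)" for m :: nat
    by (simp add: choose_two)
  have odd: "(2 * m + 1) choose 2 = m * (2 * m + 1)" for m :: nat
    by (simp add: choose_two)
  \<comment> \<open>Writing \<open>l\<close> as a successor removes the truncated subtraction in
    \<open>even\<close>.\<close>
  obtain k where k: "l = Suc k" using assms(2) by (cases l) auto
  \<comment> \<open>Both sides equal \<open>2 * l * (4 * l - 1)\<close>.\<close>
  have "2 * (((2 * l) choose 2) + ((2 * l) choose 2) + l) = (2 * l + 2 * l) choose 2"
    using even[of l] even[of "2 * l"] unfolding k by (simp add: algebra_simps)
  \<comment> \<open>The clique sizes are consecutive, so their edge counts add up to the square
    \<open>4 * l * l\<close>; both sides equal \<open>2 * l * (4 * l + 1)\<close>.\<close>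
  moreover have "2 * (((2 * l) choose 2) + ((2 * l + 1) choose 2) + l) =
      (2 * l + (2 * l + 1)) choose 2"
    using even[of l] odd[of l] odd[of "2 * l"] unfolding k by (simp add: algebra_simps)
  ultimately show ?thesis
    using assms(5) f_Gallai_double_star[OF assms(3), of "2 * l" "2 * l" l]
      f_Gallai_double_star[OF assms(3), of "2 * l" "2 * l + 1" l] assms(2)
    by (elim disjE conjE) simp_all
qed

end
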